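(* There exists a totally disconnected Polish group which has infinitesimal rank $2$. In particular, there is a totally disconnected Polish group which is not quasi non-archimedean.
   Context: A Polish group is a separable topological group whose topology admits a compatible complete metric. A topological group is totally disconnected if its connected components are singletons. For a topological group $G$, the infinitesimal rank $t_I(G)$ is the minimum $n\in\mathbb{N}\cup\{+\infty\}$ such that every neighborhood of the identity in $G$ contains $n$ elements $g_1,\dots,g_n$ which generate a dense subgroup of $G$. A topological group $G$ is quasi non-archimedean if for every $n\in\mathbb{N}$ and every neighborhood of the identity $V\subseteq G$, there exists a neighborhood of the identity $U\subseteq V$ such that for all $g_1,\dots,g_n\in U$, the group generated by $g_1,\dots,g_n$ is contained in $V$. *)

theory Defs
  imports "HOL-Analysis.Analysis" "HOL-Algebra.Generated_Groups"
begin

locale topological_group = group G for G (structure) +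
  fixes T :: "'a topology"
  assumes topspace_eq_carrier: "topspace T = carrier G"
    and continuous_mult: "continuous_map (prod_topology T T) T (\<lambda>(x, y). x \<otimes> y)"
    and continuous_inv: "continuous_map T T (\<lambda>x. inv x)"

locale polish_group = topological_group +
  assumes separable: "separable_space T"
    and completely_metrizable: "completely_metrizable_space T"

definition totally_disconnected_space :: "'a topology \<Rightarrow> bool" where
  "totally_disconnected_space T \<longleftrightarrow> (\<forall>C \<in> connected_components_of T. \<exists>x. C = {x})"

(* Neighborhoods need not be open. *)
definition is_nbhd :: "'a topology \<Rightarrow> 'a \<Rightarrow> 'a set \<Rightarrow> bool" where
  "is_nbhd T x V \<longleftrightarrow> V \<subseteq> topspace T \<and> x \<in> T interior_of V"

(* A family g_1, ..., g_n with n possibly infinite is a function restricted to the indices i < n;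
   it may have repetitions. *)
definition inf_generated ::
    "('a, 'b) monoid_scheme \<Rightarrow> 'a topology \<Rightarrow> enat \<Rightarrow> bool" where
  "inf_generated G T n \<longleftrightarrow>
     (\<forall>V. is_nbhd T \<one>\<^bsub>G\<^esub> V \<longrightarrow>
        (\<exists>g :: nat \<Rightarrow> 'a. g ` {i. enat i < n} \<subseteq> V \<and>
           T closure_of (generate G (g ` {i. enat i < n})) = topspace T))"

(* Inf on enat is the least element of a nonempty set, and Inf {} is infinity. *)
definition infinitesimal_rank :: "('a, 'b) monoid_scheme \<Rightarrow> 'a topology \<Rightarrow> enat" where
  "infinitesimal_rank G T = Inf {n. inf_generated G T n}"

definition quasi_non_archimedean ::
    "('a, 'b) monoid_scheme \<Rightarrow> 'a topology \<Rightarrow> bool" where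
  "quasi_non_archimedean G T \<longleftrightarrow>
     (\<forall>(n :: nat) V. is_nbhd T \<one>\<^bsub>G\<^esub> V \<longrightarrow>
        (\<exists>U. is_nbhd T \<one>\<^bsub>G\<^esub> U \<and> U \<subseteq> V \<and>
           (\<forall>g :: nat \<Rightarrow> 'a. g ` {..<n} \<subseteq> U \<longrightarrow> generate G (g ` {..<n}) \<subseteq> V)))"

(* HOL cannot quantify existentially over types. Asking for a group whose carrier is a subset of
   the type real loses nothing: a Polish group has at most continuum many elements, so group and
   topology can be transported along an injection into the reals. The group operation and the
   topology are arbitrary and need not be related to those of the reals. *)
type_synonym continuum = real

end

theory Submission
  imports Defs
begin

text \<open>
  The example is a subgroup \<open>H\<close> of the real line with a topology finer than the usual one.
  Let \<open>q\<^sub>n = 2 ^ 3 ^ n\<close>, and measure the size of a real number by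
  \<open>len x = \<bar>x\<bar> + sup\<^sub>n \<bar>sin (\<pi> q\<^sub>n x)\<bar>\<close>. The second summand compares \<open>q\<^sub>n x\<close> with the
  nearest integer, for all \<open>n\<close> at once, so it vanishes on integers but sees every scale.
  The function \<open>len\<close> gives a complete, translation-invariant metric on the real line, which is
  far from separable; \<open>H\<close> is the closure of the group of dyadic rationals in it. Thus \<open>H\<close> is
  Polish under addition.

  \<^bold>\<open>Total disconnectedness.\<close> A connected subset of \<open>H\<close> is connected in the line as well, so if it
  had two points, \<open>H\<close> would contain an interval. A subgroup containing an interval is everything,
  but \<open>1/3\<close> is not in \<open>H\<close>: its multiples by powers of two stay away from the integers, while a
  large power of two turns a given dyadic rational into an integer.

  \<^bold>\<open>Two small generators.\<close> Let \<open>t\<^sub>j\<close> be the sum of \<open>1/q\<^sub>i\<close> over \<open>i > j\<close>. Because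
  \<open>q\<^sub>n\<^sub>+\<^sub>1 = q\<^sub>n ^ 3\<close>, even the multiples \<open>a t\<^sub>j\<close> with \<open>0 \<le> a \<le> q\<^sub>j\<close> have length \<open>O(1/q\<^sub>j)\<close>
  (lemma \<open>len_multiple_tail\<close>). The group generated by \<open>t\<^sub>M\<close> and \<open>t\<^sub>M\<^sub>+\<^sub>1\<close> contains their
  difference, a reciprocal of an integer, hence all integers; and
  \<open>(q\<^sub>j / q\<^sub>m) t\<^sub>M\<close> is, up to an integer, \<open>1/q\<^sub>m\<close> plus the small number \<open>(q\<^sub>j / q\<^sub>m) t\<^sub>j\<close>. So
  its closure contains the dyadic rationals (lemma \<open>dense_two_tails\<close>), however large \<open>M\<close> is.

  \<^bold>\<open>Lower bound.\<close> One element generates a discrete subgroup of the line, whereas \<open>H\<close> contains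
  arbitrarily small positive numbers. Finally \<open>H\<close> is unbounded, so dense subgroups with two
  generators never stay in the open unit interval around \<open>0\<close>, and the same group fails to be
  quasi non-archimedean.
\<close>

section \<open>A lacunary sequence of powers of two\<close>

definition q :: "nat \<Rightarrow> nat" where
  "q n = 2 ^ 3 ^ n"

lemma q_pos [simp]: "q n > 0"
  by (simp add: q_def)

lemma q_nonzero [simp]: "q n \<noteq> 0"
  by (simp add: q_def)

lemma q_ge_2: "q n \<ge> 2"
proof -
  have "(2::nat) ^ 1 \<le> 2 ^ 3 ^ n"
    by (rule power_increasing) auto
  then show ?thesis by (simp add: q_def)
qed

lemma q_Suc: "q (Suc n) = q n ^ 3"
  by (simp add: q_def power_mult [symmetric] mult.commute)

lemma q_mono: "i \<le> j \<Longrightarrow> q i \<le> q j"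
  by (simp add: q_def power_increasing)

lemma q_dvd: "i \<le> j \<Longrightarrow> q i dvd q j"
  by (simp add: q_def le_imp_power_dvd power_increasing)

text \<open>This is where the sequence has to grow fast: \<open>q j\<close> is the cube of its predecessor, so that it
  is a multiple of the product of any two earlier terms.\<close>

lemma q_mult_dvd:
  assumes "m < j" "i < j"
  shows "q m * q i dvd q j"
proof -
  have "(3::nat) ^ m \<le> 3 ^ (j - 1)" "(3::nat) ^ i \<le> 3 ^ (j - 1)"
    using assms by (auto intro!: power_increasing)
  moreover have "(3::nat) ^ j = 3 * 3 ^ (j - 1)"
    using assms by (cases j) auto
  ultimately have "(3::nat) ^ m + 3 ^ i \<le> 3 ^ j"
    by linarith
  then show ?thesis
    by (simp add: q_def power_add [symmetric] le_imp_power_dvd)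
qed

lemma q_unbounded: "\<exists>n. real (q n) > x"
proof -
  have "n < q n" for n
  proof -
    have "n < 2 ^ n" by (rule less_exp)
    also have "\<dots> \<le> 3 ^ n" by (rule power_mono) auto
    also have "\<dots> < 2 ^ 3 ^ n" by (rule less_exp)
    finally show ?thesis by (simp add: q_def)
  qed
  then show ?thesis
    by (meson order_less_trans of_nat_less_iff reals_Archimedean2)
qed

section \<open>A translation-invariant length on the line\<close>

text \<open>
  The value \<open>wave n x\<close> is comparable with the distance from \<open>q n * x\<close> to the integers; the sine is
  more convenient because its continuity and subadditivity are immediate.
\<close>

definition wave :: "nat \<Rightarrow> real \<Rightarrow> real" where
  "wave n x = \<bar>sin (pi * (real (q n) * x))\<bar>"

definition len :: "real \<Rightarrow> real" where
  "len x = \<bar>x\<bar> + (SUP n. wave n x)"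

lemma wave_bdd: "bdd_above (range (\<lambda>n. wave n x))"
  by (rule bdd_aboveI [of _ 1]) (auto simp: wave_def)

lemma wave_nonneg: "0 \<le> wave n x"
  by (simp add: wave_def)

lemma wave_le_len: "\<bar>x\<bar> + wave n x \<le> len x"
  unfolding len_def by (intro add_left_mono cSUP_upper wave_bdd) auto

lemma len_le: "(\<And>n. \<bar>x\<bar> + wave n x \<le> c) \<Longrightarrow> len x \<le> c"
  unfolding len_def
  using cSUP_least [of UNIV "\<lambda>n. wave n x" "c - \<bar>x\<bar>"] by (simp add: algebra_simps)

lemma abs_le_len: "\<bar>x\<bar> \<le> len x"
  using wave_le_len [of x 0] wave_nonneg [of 0 x] by linarith

lemma len_nonneg [simp]: "0 \<le> len x"
  using abs_le_len [of x] by linarith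

lemma len_0 [simp]: "len 0 = 0"
  by (simp add: len_def wave_def)

lemma len_eq_0_iff [simp]: "len x = 0 \<longleftrightarrow> x = 0"
  using abs_le_len [of x] by force

lemma len_minus [simp]: "len (- x) = len x"
  by (simp add: len_def wave_def)

lemma len_commute: "len (x - y) = len (y - x)"
  using len_minus [of "x - y"] by simp

lemma wave_triangle: "wave n (x + y) \<le> wave n x + wave n y"
proof -
  define a b where "a = pi * (real (q n) * x)" and "b = pi * (real (q n) * y)"
  have "\<bar>sin (a + b)\<bar> \<le> \<bar>sin a * cos b\<bar> + \<bar>cos a * sin b\<bar>"
    unfolding sin_add by (rule abs_triangle_ineq)
  also have "\<dots> \<le> \<bar>sin a\<bar> * 1 + 1 * \<bar>sin b\<bar>"
    unfolding abs_mult by (intro add_mono mult_mono) auto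
  finally show ?thesis
    by (simp add: wave_def a_def b_def algebra_simps)
qed

lemma len_triangle: "len (x + y) \<le> len x + len y"
proof (rule len_le)
  fix n
  show "\<bar>x + y\<bar> + wave n (x + y) \<le> len x + len y"
    using wave_triangle [of n x y] wave_le_len [of x n] wave_le_len [of y n] by linarith
qed

lemma len_triangle_diff: "len (x - z) \<le> len (x - y) + len (y - z)"
  using len_triangle [of "x - y" "y - z"] by simp

lemma wave_shift_integer:
  assumes "real (q n) * x - y \<in> \<int>"
  shows "wave n x = \<bar>sin (pi * y)\<bar>"
proof -
  obtain k where "real (q n) * x - y = of_int k"
    using assms by (auto elim: Ints_cases)
  then have "real (q n) * x = of_int k + y"
    by simp
  then have x: "pi * (real (q n) * x) = pi * of_int k + pi * y"
    by (simp only: distrib_left)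
  have "\<bar>cos (pi * of_int k)\<bar> = (1::real)"
    by simp
  then show ?thesis
    unfolding wave_def x sin_add by (simp add: abs_mult)
qed

lemma abs_sin_pi_le: "0 \<le> y \<Longrightarrow> \<bar>sin (pi * y)\<bar> \<le> 4 * y"
proof -
  assume "0 \<le> y"
  then have "\<bar>sin (pi * y)\<bar> \<le> pi * y"
    using abs_sin_x_le_abs_x [of "pi * y"] by (simp add: abs_mult)
  also have "\<dots> \<le> 4 * y"
    using \<open>0 \<le> y\<close> pi_less_4 by (intro mult_right_mono) auto
  finally show ?thesis .
qed

text \<open>
  For \<open>a = \<pi> 2 ^ k / 3\<close> the value \<open>sin\<^sup>2 a = 3/4\<close> is fixed by angle doubling, since
  \<open>sin\<^sup>2 (2 a) = 4 sin\<^sup>2 a cos\<^sup>2 a\<close>.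
\<close>

lemma wave_third: "wave n (1/3) \<ge> 1/2"
proof -
  have "(sin (pi * (2 ^ k / 3)))\<^sup>2 = 3/4" for k :: nat
  proof (induction k)
    case 0
    then show ?case
      by (simp add: sin_60 power_divide)
  next
    case (Suc k)
    define a where "a = pi * (2 ^ k / 3)"
    have double: "pi * (2 ^ Suc k / 3) = 2 * a"
      by (simp add: a_def)
    have s: "(sin a)\<^sup>2 = 3/4"
      unfolding a_def by (rule Suc.IH)
    have c: "(cos a)\<^sup>2 = 1/4"
      using cos_squared_eq [of a] s by linarith
    show ?case
      unfolding double sin_double power_mult_distrib s c by simp
  qed
  from this [of "3 ^ n"] have "(wave n (1/3))\<^sup>2 = 3/4"
    by (simp add: wave_def q_def)
  then have "(1/2)\<^sup>2 \<le> (wave n (1/3))\<^sup>2"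
    by (simp add: power_divide)
  then show ?thesis
    using wave_nonneg by (rule power2_le_imp_le)
qed

section \<open>Tails of the series of reciprocals\<close>

definition tail :: "nat \<Rightarrow> real" where
  "tail j = (\<Sum>i. 1 / real (q (i + Suc j)))"

lemma inverse_q_le_geometric: "1 / real (q (i + j)) \<le> (1/2) ^ i * (1 / real (q j))"
proof (induction i)
  case (Suc i)
  have "2 * q (i + j) \<le> q (i + j) ^ 3"
    using mult_le_mono [OF q_ge_2 [of "i + j"] q_ge_2 [of "i + j"]]
    by (simp add: power3_eq_cube)
  then have "real (2 * q (i + j)) \<le> real (q (Suc i + j))"
    by (simp only: q_Suc add_Suc of_nat_le_iff)
  then have "1 / real (q (Suc i + j)) \<le> 1 / (2 * real (q (i + j)))"
    by (intro divide_left_mono) auto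
  also have "\<dots> \<le> (1/2) ^ Suc i * (1 / real (q j))"
    using Suc by simp
  finally show ?case .
qed auto

lemma summable_inverse_q: "summable (\<lambda>i. 1 / real (q (i + j)))"
  by (rule summable_comparison_test' [of "\<lambda>i. (1/2) ^ i * (1 / real (q j))"])
    (use inverse_q_le_geometric in \<open>auto intro!: summable_mult2 summable_geometric\<close>)

lemma tail_nonneg: "0 \<le> tail j"
  unfolding tail_def by (intro suminf_nonneg summable_inverse_q) auto

lemma tail_le: "tail j \<le> 2 / real (q (Suc j))"
proof -
  have "tail j \<le> (\<Sum>i. (1/2) ^ i * (1 / real (q (Suc j))))"
    unfolding tail_def
    by (intro suminf_le inverse_q_le_geometric summable_inverse_q summable_mult2)
      (auto intro: summable_geometric)
  also have "\<dots> = 2 / real (q (Suc j))"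
    by (subst suminf_mult2 [symmetric]) (auto simp: suminf_geometric)
  finally show ?thesis .
qed

lemma tail_rec: "tail j = 1 / real (q (Suc j)) + tail (Suc j)"
  using suminf_split_head [OF summable_inverse_q [of "Suc j"]] by (simp add: tail_def)

lemma tail_split: "j \<le> n \<Longrightarrow> tail j = (\<Sum>i\<in>{j<..n}. 1 / real (q i)) + tail n"
proof (induction n rule: dec_induct)
  case (step n)
  then have "{j<..Suc n} = insert (Suc n) {j<..n}"
    by auto
  then show ?case
    using step.IH tail_rec [of n] by simp
qed auto

lemma q_squared_tail_le: "(real (q j))\<^sup>2 * tail j \<le> 2 / real (q j)"
proof -
  have "(real (q j))\<^sup>2 * tail j \<le> (real (q j))\<^sup>2 * (2 / real (q (Suc j)))"
    by (intro mult_left_mono tail_le) auto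
  also have "\<dots> = 2 / real (q j)"
    by (simp add: q_Suc field_simps power2_eq_square power3_eq_cube)
  finally show ?thesis .
qed

lemma q_sum_in_Ints:
  assumes "\<And>i. i \<in> A \<Longrightarrow> i \<le> n"
  shows "real (q n) * (\<Sum>i\<in>A. 1 / real (q i)) \<in> \<int>"
  unfolding sum_distrib_left
proof (rule Ints_sum)
  fix i assume "i \<in> A"
  then obtain c where "q n = q i * c"
    using q_dvd [OF assms] by (auto elim: dvdE)
  then show "real (q n) * (1 / real (q i)) \<in> \<int>"
    by simp
qed

text \<open>
  In the estimate of \<open>wave n\<close> there are two regimes. For \<open>n \<le> j\<close> the number \<open>q n * a * tail j\<close> is
  itself at most \<open>(q j)\<^sup>2 * tail j\<close>, which is small. For \<open>n > j\<close> the terms of the tail up to index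
  \<open>n\<close> become integers after multiplication by \<open>q n\<close>, so only \<open>q n * a * tail n\<close> matters, which is
  at most \<open>(q n)\<^sup>2 * tail n\<close>.
\<close>

lemma len_multiple_tail:
  assumes a: "a \<le> q j"
  shows "len (real a * tail j) \<le> 10 / real (q j)"
proof (rule len_le)
  fix n
  define Q where "Q = real (q j)"
  have Q: "Q \<ge> 1"
    using q_ge_2 [of j] by (simp add: Q_def)
  have aQ: "real a \<le> Q"
    using a by (simp add: Q_def)
  have small: "Q * (Q * tail j) \<le> 2 / Q"
    using q_squared_tail_le [of j] by (simp add: Q_def power2_eq_square mult.assoc)
  have abs: "\<bar>real a * tail j\<bar> \<le> 2 / Q"
  proof -
    have "1 * (real a * tail j) \<le> Q * (Q * tail j)"
      using Q aQ tail_nonneg by (intro mult_mono) auto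
    then show ?thesis
      using small tail_nonneg [of j] by (simp add: abs_mult)
  qed
  obtain y where y: "real (q n) * (real a * tail j) - y \<in> \<int>" "0 \<le> y" "y \<le> 2 / Q"
  proof (cases "n \<le> j")
    case True
    have "real (q n) * (real a * tail j) \<le> Q * (Q * tail j)"
      using q_mono [OF True] aQ tail_nonneg Q by (intro mult_mono) (auto simp: Q_def)
    then show ?thesis
      using small tail_nonneg [of j] by (intro that [of "real (q n) * (real a * tail j)"]) auto
  next
    case False
    then have "j \<le> n" by simp
    have "real (q n) * (real a * tail j) - real (q n) * (real a * tail n)
        = real a * (real (q n) * (\<Sum>i\<in>{j<..n}. 1 / real (q i)))"
      by (subst tail_split [OF \<open>j \<le> n\<close>]) (simp add: algebra_simps)
    also have "\<dots> \<in> \<int>"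
      by (intro Ints_mult q_sum_in_Ints) auto
    finally have int: "real (q n) * (real a * tail j) - real (q n) * (real a * tail n) \<in> \<int>" .
    have "real (q n) * (real a * tail n) \<le> real (q n) * (real (q n) * tail n)"
      using a q_mono [OF \<open>j \<le> n\<close>] tail_nonneg by (intro mult_left_mono mult_right_mono) auto
    also have "\<dots> \<le> 2 / real (q n)"
      using q_squared_tail_le [of n] by (simp add: power2_eq_square mult.assoc)
    also have "\<dots> \<le> 2 / Q"
      using q_mono [OF \<open>j \<le> n\<close>] by (auto simp: Q_def intro!: divide_left_mono)
    finally show ?thesis
      using int tail_nonneg [of n] by (intro that) auto
  qed
  \<comment> \<open>The constant 10 is the 2 from the absolute value plus \<open>4 * 2\<close>, with 4 an upper bound for \<open>\<pi>\<close>.\<close>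
  have "wave n (real a * tail j) \<le> 4 * (2 / Q)"
    using wave_shift_integer [OF y(1)] abs_sin_pi_le [OF y(2)] y(3) by linarith
  then have "\<bar>real a * tail j\<bar> + wave n (real a * tail j) \<le> 2 / Q + 4 * (2 / Q)"
    using abs by linarith
  also have "\<dots> = 10 / Q"
    by simp
  finally show "\<bar>real a * tail j\<bar> + wave n (real a * tail j) \<le> 10 / real (q j)"
    by (simp only: Q_def)
qed

lemma len_tail_less:
  assumes "10 / real (q j) < e"
  shows "len (tail j) < e"
  using len_multiple_tail [of 1 j] q_ge_2 [of j] assms by simp

lemma eventually_inverse_q_small:
  assumes "e > 0"
  shows "\<exists>M. \<forall>j\<ge>M. 10 / real (q j) < e"
proof -
  obtain M where M: "real (q M) > 10 / e"
    using q_unbounded by blast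
  have "10 / real (q j) < e" if "M \<le> j" for j
  proof -
    have "10 / e < real (q j)"
      using M q_mono [OF that] by linarith
    then show ?thesis
      using assms by (simp add: field_simps)
  qed
  then show ?thesis by blast
qed

section \<open>The group\<close>

definition dyadics :: "real set" where
  "dyadics = {of_int a / real (q m) | a m. True}"

text \<open>Closing up a countable subgroup inside a complete metric group gives separability and
  completeness together.\<close>

definition H :: "real set" where
  "H = {x. \<forall>e>0. \<exists>r\<in>dyadics. len (x - r) < e}"

definition HG :: "real monoid" where
  "HG = \<lparr>carrier = H, mult = (+), one = 0\<rparr>"

text \<open>Every dyadic rational has the form in the definition, with denominator any sufficiently late
  term of the sequence; hence two of them have a common denominator.\<close>

lemma dyadics_refine:
  assumes "m \<le> n"
  shows "\<exists>b. of_int a / real (q m) = of_int b / real (q n)"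
proof -
  obtain c where c: "q n = q m * c"
    using q_dvd [OF assms] by (auto elim: dvdE)
  then have "c \<noteq> 0"
    using q_pos [of n] by (intro notI) simp
  then have "of_int a / real (q m) = of_int (a * int c) / real (q n)"
    unfolding c by simp
  then show ?thesis ..
qed

lemma dyadics_add:
  assumes "x \<in> dyadics" "y \<in> dyadics"
  shows "x + y \<in> dyadics"
proof -
  obtain a m b n where xy: "x = of_int a / real (q m)" "y = of_int b / real (q n)"
    using assms by (auto simp: dyadics_def)
  obtain a' b' where "x = of_int a' / real (q (max m n))" "y = of_int b' / real (q (max m n))"
    using dyadics_refine [of m "max m n" a] dyadics_refine [of n "max m n" b] xy by auto
  then have "x + y = of_int (a' + b') / real (q (max m n))"
    by (simp add: add_divide_distrib)
  then show ?thesis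
    unfolding dyadics_def by blast
qed

lemma dyadics_minus:
  assumes "x \<in> dyadics"
  shows "- x \<in> dyadics"
proof -
  obtain a m where "x = of_int a / real (q m)"
    using assms by (auto simp: dyadics_def)
  then have "- x = of_int (- a) / real (q m)"
    by simp
  then show ?thesis
    unfolding dyadics_def by blast
qed

lemma countable_dyadics: "countable dyadics"
proof (rule countable_subset)
  define f :: "int \<times> nat \<Rightarrow> real" where "f = (\<lambda>p. of_int (fst p) / real (q (snd p)))"
  show "dyadics \<subseteq> range f"
  proof
    fix x assume "x \<in> dyadics"
    then obtain a m where "x = of_int a / real (q m)"
      by (auto simp: dyadics_def)
    then have "x = f (a, m)"
      by (simp add: f_def)
    then show "x \<in> range f"
      by (rule range_eqI)
  qed
qed simp

lemma inverse_q_in_dyadics: "1 / real (q m) \<in> dyadics"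
proof -
  have "1 / real (q m) = of_int 1 / real (q m)"
    by simp
  then show ?thesis
    unfolding dyadics_def by blast
qed

lemma H_approx: "x \<in> H \<Longrightarrow> e > 0 \<Longrightarrow> \<exists>r\<in>dyadics. len (x - r) < e"
  by (simp add: H_def)

lemma H_I: "(\<And>e. e > 0 \<Longrightarrow> \<exists>r\<in>dyadics. len (x - r) < e) \<Longrightarrow> x \<in> H"
  by (simp add: H_def)

lemma dyadics_subset_H: "dyadics \<subseteq> H"
proof
  fix x assume "x \<in> dyadics"
  then show "x \<in> H"
    by (intro H_I bexI [of _ x]) auto
qed

lemma int_in_dyadics: "of_int k \<in> dyadics"
proof -
  have "of_int k = of_int (k * int (q 0)) / real (q 0)"
    by simp
  then show ?thesis
    unfolding dyadics_def by blast
qed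

lemma H_closed:
  assumes "\<And>e. e > 0 \<Longrightarrow> \<exists>y\<in>H. len (x - y) < e"
  shows "x \<in> H"
proof (rule H_I)
  fix e :: real assume "e > 0"
  then obtain y where y: "y \<in> H" "len (x - y) < e/2"
    using assms [of "e/2"] by auto
  then obtain r where r: "r \<in> dyadics" "len (y - r) < e/2"
    using H_approx [of y "e/2"] \<open>e > 0\<close> by auto
  have "len (x - r) < e"
    using len_triangle_diff [of x r y] y r by linarith
  with r show "\<exists>r\<in>dyadics. len (x - r) < e"
    by blast
qed

lemma H_0: "0 \<in> H"
  using int_in_dyadics [of 0] dyadics_subset_H by auto

lemma H_minus:
  assumes "x \<in> H"
  shows "- x \<in> H"
proof (rule H_I)
  fix e :: real assume "e > 0"
  then obtain r where r: "r \<in> dyadics" "len (x - r) < e"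
    using H_approx [OF assms] by blast
  have "len (- x - - r) < e"
    using r len_minus [of "x - r"] by simp
  then show "\<exists>r\<in>dyadics. len (- x - r) < e"
    using dyadics_minus [OF r(1)] by blast
qed

lemma H_add:
  assumes "x \<in> H" "y \<in> H"
  shows "x + y \<in> H"
proof (rule H_I)
  fix e :: real assume "e > 0"
  then have "e/2 > 0" by simp
  obtain r where r: "r \<in> dyadics" "len (x - r) < e/2"
    using H_approx [OF assms(1) \<open>e/2 > 0\<close>] by blast
  obtain s where s: "s \<in> dyadics" "len (y - s) < e/2"
    using H_approx [OF assms(2) \<open>e/2 > 0\<close>] by blast
  have eq: "x + y - (r + s) = (x - r) + (y - s)"
    by simp
  have "len (x + y - (r + s)) < e"
    unfolding eq using len_triangle [of "x - r" "y - s"] r s by linarith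
  then show "\<exists>r\<in>dyadics. len (x + y - r) < e"
    using dyadics_add [OF r(1) s(1)] by blast
qed

lemma H_nat_mult: "x \<in> H \<Longrightarrow> real n * x \<in> H"
  by (induction n) (auto simp: H_0 H_add distrib_right)

lemma tail_in_H: "tail j \<in> H"
proof (rule H_closed)
  fix e :: real assume "e > 0"
  then obtain M where M: "\<forall>j\<ge>M. 10 / real (q j) < e"
    using eventually_inverse_q_small by blast
  define n where "n = max j M"
  have "1 / real (q i) \<in> H" for i
    using dyadics_subset_H inverse_q_in_dyadics by blast
  then have "(\<Sum>i\<in>A. 1 / real (q i)) \<in> H" for A
    by (induction A rule: infinite_finite_induct) (auto simp: H_0 H_add)
  moreover have "tail j - (\<Sum>i\<in>{j<..n}. 1 / real (q i)) = tail n"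
    using tail_split [of j n] by (simp add: n_def)
  moreover have "len (tail n) < e"
    by (rule len_tail_less) (use M in \<open>simp add: n_def\<close>)
  ultimately show "\<exists>y\<in>H. len (tail j - y) < e"
    by metis
qed

text \<open>A dyadic rational \<open>r\<close> has integral multiple \<open>q m * r\<close> for some \<open>m\<close>, so subtracting it does not
  change \<open>wave m (1/3)\<close>, which is at least \<open>1/2\<close>.\<close>

lemma third_notin_H: "1/3 \<notin> H"
proof
  assume "1/3 \<in> H"
  then obtain r where "r \<in> dyadics" and r: "len (1/3 - r) < 1/2"
    using H_approx [of "1/3" "1/2"] by auto
  then obtain a m where "r = of_int a / real (q m)"
    by (auto simp: dyadics_def)
  then have "wave m (1/3 - r) = wave m (1/3)"
    using wave_shift_integer [of m "1/3 - r" "real (q m) * (1/3)"] 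
    by (simp add: right_diff_distrib wave_def)
  then show False
    using wave_third [of m] wave_le_len [of "1/3 - r" m] r by linarith
qed

interpretation H: Metric_space H "\<lambda>x y. len (x - y)"
  by standard (auto simp: len_commute len_triangle_diff)

abbreviation HT :: "real topology" where
  "HT \<equiv> H.mtopology"

lemma group_HG: "group HG"
  by (rule groupI) (auto simp: HG_def H_0 H_add intro!: bexI [of _ "- _"] H_minus)

lemma HG_simps [simp]:
  "carrier HG = H" "x \<otimes>\<^bsub>HG\<^esub> y = x + y" "\<one>\<^bsub>HG\<^esub> = 0"
  by (auto simp: HG_def)

lemma HG_inv [simp]: "x \<in> H \<Longrightarrow> inv\<^bsub>HG\<^esub> x = - x"
  by (rule group.inv_equality [OF group_HG]) (auto simp: H_minus)

text \<open>
  A Cauchy sequence converges in the usual topology to some \<open>x\<close>. Each single \<open>wave n\<close> is continuous,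
  so the Cauchy estimate passes to the limit for every \<open>n\<close> with the same bound, hence for the
  supremum over \<open>n\<close>.
\<close>

lemma H_mcomplete: "H.mcomplete"
  unfolding H.mcomplete_def
proof (intro allI impI)
  fix s assume s: "H.MCauchy s"
  then have sH: "s n \<in> H" for n
    by (auto simp: H.MCauchy_def)
  have "Cauchy s"
    unfolding Cauchy_def dist_real_def
    using s abs_le_len order_le_less_trans unfolding H.MCauchy_def by meson
  then obtain x where x: "s \<longlonglongrightarrow> x"
    using Cauchy_convergent convergent_def by blast
  have lim: "\<exists>N. \<forall>k\<ge>N. len (s k - x) < e" if "e > 0" for e
  proof -
    obtain N where N: "\<And>k l. N \<le> k \<Longrightarrow> N \<le> l \<Longrightarrow> len (s k - s l) < e/2"
      using s \<open>e > 0\<close> unfolding H.MCauchy_def by (meson half_gt_zero)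
    have "len (s k - x) \<le> e/2" if k: "k \<ge> N" for k
    proof (rule len_le)
      fix n
      have "(\<lambda>l. \<bar>s k - s l\<bar> + wave n (s k - s l)) \<longlonglongrightarrow> \<bar>s k - x\<bar> + wave n (s k - x)"
        unfolding wave_def by (intro tendsto_intros x)
      moreover have "\<bar>s k - s l\<bar> + wave n (s k - s l) \<le> e/2" if "l \<ge> N" for l
        using N [OF k that] wave_le_len [of "s k - s l" n] by linarith
      ultimately show "\<bar>s k - x\<bar> + wave n (s k - x) \<le> e/2"
        by (blast intro: Lim_bounded)
    qed
    then show ?thesis
      using \<open>e > 0\<close> by (intro exI [of _ N]) force
  qed
  moreover have "x \<in> H"
  proof (rule H_closed)
    fix e :: real assume "e > 0"
    then obtain N where "len (s N - x) < e"
      using lim by blast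
    then show "\<exists>y\<in>H. len (x - y) < e"
      using sH len_commute [of x "s N"] by (intro bexI [of _ "s N"]) auto
  qed
  ultimately show "\<exists>x. limitin HT s x sequentially"
    using sH by (auto simp: H.limitin_metric eventually_sequentially)
qed

lemma HG_polish: "polish_group HG HT"
proof -
  interpret group HG by (rule group_HG)
  show ?thesis
  proof
    show "topspace HT = carrier HG" by simp
    show "continuous_map (prod_topology HT HT) HT (\<lambda>(x, y). x \<otimes>\<^bsub>HG\<^esub> y)"
      unfolding continuous_map_def
    proof (intro conjI allI impI)
      show "(\<lambda>(x, y). x \<otimes>\<^bsub>HG\<^esub> y) \<in> topspace (prod_topology HT HT) \<rightarrow> topspace HT"
        by (auto simp: H_add)
      fix U assume U: "openin HT U"
      show "openin (prod_topology HT HT) {z \<in> topspace (prod_topology HT HT). (case z of (x, y) \<Rightarrow> x \<otimes>\<^bsub>HG\<^esub> y) \<in> U}"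
        unfolding openin_prod_topology_alt
      proof (intro allI impI)
        fix x y
        assume "(x, y) \<in> {z \<in> topspace (prod_topology HT HT). (case z of (x, y) \<Rightarrow> x \<otimes>\<^bsub>HG\<^esub> y) \<in> U}"
        then have xy: "x \<in> H" "y \<in> H" "x + y \<in> U"
          by auto
        then obtain r where r: "r > 0" "H.mball (x + y) r \<subseteq> U"
          using U by (auto simp: H.openin_mtopology)
        have "x' + y' \<in> U" if "x' \<in> H.mball x (r/2)" "y' \<in> H.mball y (r/2)" for x' y'
        proof -
          have "len (x + y - (x' + y')) < r"
            using that len_triangle [of "x - x'" "y - y'"] by (simp add: algebra_simps)
          then show ?thesis
            using that r xy by (intro subsetD [OF r(2)]) (auto simp: H_add)
        qed
        then show "\<exists>A B. openin HT A \<and> openin HT B \<and> x \<in> A \<and> y \<in> B \<and>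
            A \<times> B \<subseteq> {z \<in> topspace (prod_topology HT HT). (case z of (x, y) \<Rightarrow> x \<otimes>\<^bsub>HG\<^esub> y) \<in> U}"
          using xy r
          by (intro exI [of _ "H.mball x (r/2)"] exI [of _ "H.mball y (r/2)"]) auto
      qed
    qed
    show "continuous_map HT HT (\<lambda>x. inv\<^bsub>HG\<^esub> x)"
      unfolding continuous_map_def
    proof (intro conjI allI impI)
      show "(\<lambda>x. inv\<^bsub>HG\<^esub> x) \<in> topspace HT \<rightarrow> topspace HT"
        by (auto simp: H_minus)
      fix U assume U: "openin HT U"
      show "openin HT {x \<in> topspace HT. inv\<^bsub>HG\<^esub> x \<in> U}"
        unfolding H.openin_mtopology
      proof (intro conjI allI impI)
        fix x assume "x \<in> {x \<in> topspace HT. inv\<^bsub>HG\<^esub> x \<in> U}"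
        then have x: "x \<in> H" "- x \<in> U" by auto
        then obtain r where r: "r > 0" "H.mball (- x) r \<subseteq> U"
          using U by (auto simp: H.openin_mtopology)
        have "- y \<in> U" if "y \<in> H.mball x r" for y
          using that x len_commute [of x y] by (intro subsetD [OF r(2)]) (auto simp: H_minus)
        then show "\<exists>r>0. H.mball x r \<subseteq> {x \<in> topspace HT. inv\<^bsub>HG\<^esub> x \<in> U}"
          using r by (intro exI [of _ r]) auto
      qed auto
    qed
    show "separable_space HT"
      unfolding separable_space_def
    proof (intro exI conjI)
      show "countable dyadics" by (rule countable_dyadics)
      show "dyadics \<subseteq> topspace HT" using dyadics_subset_H by simp
      have "\<exists>r\<in>dyadics. r \<in> H.mball x e" if "x \<in> H" "e > 0" for x e
        using that dyadics_subset_H H_approx [of x e] by auto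
      then show "HT closure_of dyadics = topspace HT"
        by (auto simp: H.metric_closure_of)
    qed
    show "completely_metrizable_space HT"
      using H.completely_metrizable_space_mtopology H_mcomplete by blast
  qed
qed

lemma openin_HT_real:
  assumes "open U"
  shows "openin HT (H \<inter> U)"
  unfolding H.openin_mtopology
proof (intro conjI allI impI)
  fix x assume x: "x \<in> H \<inter> U"
  then obtain r where r: "r > 0" "ball x r \<subseteq> U"
    using assms by (auto simp: open_contains_ball)
  have "H.mball x r \<subseteq> H \<inter> U"
  proof
    fix y assume "y \<in> H.mball x r"
    then have "y \<in> H" "dist x y < r"
      using abs_le_len [of "x - y"] by (auto simp: dist_real_def)
    then show "y \<in> H \<inter> U" using r by auto
  qed
  then show "\<exists>r>0. H.mball x r \<subseteq> H \<inter> U"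
    using r by blast
qed auto

text \<open>Otherwise the subgroup \<open>H\<close> would contain every sufficiently small positive number, in
  particular \<open>1/(3 n)\<close> for large \<open>n\<close>, and therefore \<open>1/3\<close>.\<close>

lemma interval_not_subset_H:
  assumes "a < b"
  shows "\<not> {a..b} \<subseteq> H"
proof
  assume sub: "{a..b} \<subseteq> H"
  obtain n where n: "real n > 1 / (3 * (b - a))"
    using reals_Archimedean2 by blast
  have "1 / (3 * (b - a)) > 0"
    using assms by simp
  then have "n > 0"
    using n by (intro Nat.gr0I) auto
  then have "a + 1 / (3 * real n) \<in> {a..b}"
    using n assms by (simp add: field_simps)
  then have "a + 1 / (3 * real n) \<in> H" "a \<in> H"
    using sub assms by auto
  then have "(a + 1 / (3 * real n)) + - a \<in> H"
    by (rule H_add [OF _ H_minus])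
  then have "1 / (3 * real n) \<in> H"
    by simp
  then have "real n * (1 / (3 * real n)) \<in> H"
    by (rule H_nat_mult)
  then show False
    using third_notin_H \<open>n > 0\<close> by simp
qed

lemma HT_totally_disconnected: "totally_disconnected_space HT"
  unfolding totally_disconnected_space_def
proof
  fix C assume C: "C \<in> connected_components_of HT"
  then have conn: "connectedin HT C" and "C \<noteq> {}"
    by (auto simp: connectedin_connected_components_of nonempty_connected_components_of)
  then have "C \<subseteq> H"
    using connectedin_subset_topspace [OF conn] by simp
  have "continuous_map HT euclidean (\<lambda>x. x)"
    unfolding continuous_map_def
    using openin_HT_real by (auto simp: Collect_conj_eq)
  then have "connected C"
    using connectedin_continuous_map_image [OF _ conn] by force
  then have "\<not> a < b" if "a \<in> C" "b \<in> C" for a b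
    using that \<open>C \<subseteq> H\<close> interval_not_subset_H connected_contains_Icc by (meson order_trans)
  then show "\<exists>x. C = {x}"
    using \<open>C \<noteq> {}\<close> by (metis ex_in_conv is_singletonI' is_singleton_def linorder_neqE)
qed

section \<open>Two generators are enough\<close>

lemma generate_int_mult:
  assumes "S \<subseteq> H" "x \<in> generate HG S"
  shows "of_int k * x \<in> generate HG S"
proof -
  have sub: "subgroup (generate HG S) HG"
    using group.generate_is_subgroup [OF group_HG] assms by simp
  have inH: "y \<in> generate HG S \<Longrightarrow> y \<in> H" for y
    using subgroup.subset [OF sub] by auto
  have nat: "real n * x \<in> generate HG S" for n
  proof (induction n)
    case 0
    then show ?case using generate.one [of HG S] by simp
  next
    case (Suc n)
    then show ?case
      using generate.eng [OF assms(2), of "real n * x"] by (simp add: algebra_simps)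
  qed
  show ?thesis
  proof (cases "k \<ge> 0")
    case True
    then show ?thesis using nat [of "nat k"] by simp
  next
    case False
    have "inv\<^bsub>HG\<^esub> (real (nat (- k)) * x) \<in> generate HG S"
      by (rule subgroup.m_inv_closed [OF sub nat])
    then show ?thesis
      unfolding HG_inv [OF inH [OF nat]] using False by simp
  qed
qed

text \<open>
  It suffices to approximate dyadic rationals \<open>b / q m\<close>. Since the generated group \<open>K\<close> contains the
  integers, \<open>b\<close> may be reduced to its remainder \<open>a < q m\<close>. With \<open>c = q j / q m\<close>, the multiple
  \<open>a c\<close> of \<open>tail M\<close> splits into an integer (the terms before index \<open>j\<close>), the wanted \<open>a / q m\<close>
  (the term with index \<open>j\<close>) and an error \<open>a c * tail j\<close>. As \<open>a c \<le> q j\<close>, the error tends to \<open>0\<close>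
  when \<open>j\<close> grows.
\<close>

lemma dense_two_tails:
  "HT closure_of (generate HG {tail M, tail (Suc M)}) = topspace HT"
proof -
  define K where "K = generate HG {tail M, tail (Suc M)}"
  have SH: "{tail M, tail (Suc M)} \<subseteq> H"
    by (simp add: tail_in_H)
  have K_add: "x + y \<in> K" if "x \<in> K" "y \<in> K" for x y
    using generate.eng [of x HG _ y] that by (simp add: K_def)
  have K_mult: "of_int k * x \<in> K" if "x \<in> K" for k x
    using generate_int_mult [OF SH] that by (simp add: K_def)
  have K_tail: "tail M \<in> K" "tail (Suc M) \<in> K"
    by (auto simp: K_def intro: generate.incl)
  have "K \<subseteq> H"
    using group.generate_incl [OF group_HG, of "{tail M, tail (Suc M)}"] SH by (simp add: K_def)
  have "1 / real (q (Suc M)) \<in> K"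
    using K_add [OF K_tail(1) K_mult [OF K_tail(2), of "-1"]] tail_rec [of M] by simp
  from K_mult [OF this, of "k * int (q (Suc M))" for k] have K_int: "of_int k \<in> K" for k
    by simp
  have approx: "\<exists>y\<in>K. len (r - y) < e" if "r \<in> dyadics" "e > 0" for r e
  proof -
    obtain b m where r: "r = of_int b / real (q m)"
      using \<open>r \<in> dyadics\<close> by (auto simp: dyadics_def)
    define a where "a = nat (b mod int (q m))"
    have "b = b div int (q m) * int (q m) + int a"
      by (simp add: a_def)
    then have b: "of_int b = of_int (b div int (q m)) * real (q m) + real a"
      by (metis of_int_add of_int_mult of_int_of_nat_eq)
    have a: "a \<le> q m"
      unfolding a_def by (simp add: nat_le_iff less_imp_le)
    obtain M' where M': "\<forall>j\<ge>M'. 10 / real (q j) < e"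
      using eventually_inverse_q_small \<open>e > 0\<close> by blast
    define j where "j = Suc (max M' (max m M))"
    have j: "m < j" "M < j" "M' \<le> j"
      by (auto simp: j_def)
    obtain c where c: "q j = q m * c"
      using q_dvd [of m j] j by (auto elim: dvdE)
    have "real (a * c) * (\<Sum>i\<in>{M<..<j}. 1 / real (q i)) \<in> \<int>"
      unfolding sum_distrib_left
    proof (rule Ints_sum)
      fix i assume "i \<in> {M<..<j}"
      then obtain d where "q j = q m * q i * d"
        using q_mult_dvd [of m j i] j by (auto elim: dvdE)
      then have "c = q i * d"
        using c by (simp add: mult.assoc)
      then show "real (a * c) * (1 / real (q i)) \<in> \<int>"
        by simp
    qed
    then obtain l where l: "real (a * c) * (\<Sum>i\<in>{M<..<j}. 1 / real (q i)) = of_int l"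
      by (auto elim: Ints_cases)
    have "{M<..j} = insert j {M<..<j}"
      using j by auto
    then have "tail M = (\<Sum>i\<in>{M<..<j}. 1 / real (q i)) + 1 / real (q j) + tail j"
      using tail_split [of M j] j by simp
    then have "real (a * c) * tail M = of_int l + real (a * c) / real (q j) + real (a * c) * tail j"
      by (simp add: l [symmetric] algebra_simps)
    moreover have "real (a * c) / real (q j) = real a / real (q m)"
      using c q_pos [of j] by auto
    ultimately have e1: "real (a * c) * tail M = of_int l + real a / real (q m) + real (a * c) * tail j"
      by simp
    define y where "y = of_int (b div int (q m) - l) + of_int (int (a * c)) * tail M"
    have "y \<in> K"
      unfolding y_def by (intro K_add K_int K_mult K_tail)
    moreover have "r - y = - (real (a * c) * tail j)"
      using e1 by (simp add: r b y_def add_divide_distrib)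
    then have "len (r - y) = len (real (a * c) * tail j)"
      by (metis len_minus)
    moreover have "\<dots> \<le> 10 / real (q j)"
      using a c by (intro len_multiple_tail) simp
    ultimately show ?thesis
      using M' j by force
  qed
  have "\<exists>y\<in>K. y \<in> H.mball x e" if "x \<in> H" "e > 0" for x e
  proof -
    obtain r where r: "r \<in> dyadics" "len (x - r) < e/2"
      using H_approx [of x "e/2"] \<open>x \<in> H\<close> half_gt_zero [OF \<open>e > 0\<close>] by blast
    obtain y where y: "y \<in> K" "len (r - y) < e/2"
      using approx [OF r(1) half_gt_zero [OF \<open>e > 0\<close>]] by blast
    have "len (x - y) < e"
      using len_triangle_diff [of x y r] r(2) y(2) by linarith
    moreover have "y \<in> H"
      using y(1) \<open>K \<subseteq> H\<close> by blast
    ultimately show ?thesis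
      using y(1) \<open>x \<in> H\<close> by (intro bexI [of _ y]) simp_all
  qed
  then show ?thesis
    unfolding K_def [symmetric] H.metric_closure_of H.topspace_mtopology by blast
qed

lemma inf_generated_2: "inf_generated HG HT 2"
  unfolding inf_generated_def
proof (intro allI impI)
  fix V assume V: "is_nbhd HT \<one>\<^bsub>HG\<^esub> V"
  then obtain e where e: "e > 0" "H.mball 0 e \<subseteq> V"
    unfolding is_nbhd_def interior_of_def H.openin_mtopology by auto
  then obtain M where M: "\<forall>j\<ge>M. 10 / real (q j) < e"
    using eventually_inverse_q_small by blast
  define g where "g i = tail (M + i)" for i
  have two: "{i. enat i < 2} = {0, 1}"
    by (auto simp: numeral_eq_enat)
  have "tail j \<in> V" if "j \<ge> M" for j
  proof -
    have "len (tail j) < e"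
      by (rule len_tail_less) (use M that in simp)
    then show ?thesis
      using tail_in_H H_0 by (intro subsetD [OF e(2)]) simp
  qed
  then have "g ` {i. enat i < 2} \<subseteq> V"
    by (auto simp: g_def)
  moreover have "g ` {i. enat i < 2} = {tail M, tail (Suc M)}"
    by (auto simp: two g_def)
  ultimately show "\<exists>g. g ` {i. enat i < 2} \<subseteq> V \<and>
      HT closure_of generate HG (g ` {i. enat i < 2}) = topspace HT"
    using dense_two_tails by metis
qed

section \<open>One generator is not enough\<close>

lemma is_nbhd_H: "is_nbhd HT \<one>\<^bsub>HG\<^esub> H"
  unfolding is_nbhd_def using interior_of_topspace [of HT] H_0 by simp

lemma dense_meets_open_interval:
  assumes "HT closure_of S = topspace HT" "a < b" "x \<in> H" "a < x" "x < b"
  shows "\<exists>y\<in>S. a < y \<and> y < b"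
proof -
  have "x \<in> HT closure_of S"
    using assms by simp
  moreover have "x \<in> H \<inter> {a<..<b}" "openin HT (H \<inter> {a<..<b})"
    using assms openin_HT_real [of "{a<..<b}"] by auto
  ultimately have "\<exists>y. y \<in> S \<and> y \<in> H \<inter> {a<..<b}"
    unfolding in_closure_of by blast
  then show ?thesis by auto
qed

text \<open>
  No integer multiple of \<open>c\<close> lies strictly between \<open>0\<close> and \<open>\<bar>c\<bar>\<close>, although \<open>H\<close> has elements
  there. Taking \<open>S \<subseteq> {c}\<close> covers the empty family together with the families of one element.
\<close>

lemma not_dense_one_generator:
  assumes "c \<in> H" "S \<subseteq> {c}"
  shows "HT closure_of (generate HG S) \<noteq> topspace HT"
proof
  assume dense: "HT closure_of (generate HG S) = topspace HT"
  have gen: "y \<in> range (\<lambda>k. of_int k * c)" if "y \<in> generate HG S" for y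
    using that
  proof induction
    case one
    show ?case by (rule range_eqI [of _ _ 0]) simp
  next
    case (incl h)
    then show ?case using assms by (intro range_eqI [of _ _ 1]) auto
  next
    case (inv h)
    then show ?case using assms by (intro range_eqI [of _ _ "-1"]) auto
  next
    case (eng h1 h2)
    then show ?case by (auto simp flip: distrib_right of_int_add)
  qed
  \<comment> \<open>For \<open>c = 0\<close> the generated group is trivial and any positive bound will do.\<close>
  define b where "b = (if c = 0 then 1 else \<bar>c\<bar>)"
  have "b > 0" by (simp add: b_def)
  obtain m where "real (q m) > 1 / b"
    using q_unbounded by blast
  then have "0 < 1 / real (q m)" "1 / real (q m) < b"
    using \<open>b > 0\<close> by (auto simp: field_simps)
  moreover have "1 / real (q m) \<in> H"
    using dyadics_subset_H inverse_q_in_dyadics by blast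
  ultimately obtain y where "y \<in> generate HG S" "0 < y" "y < b"
    using dense_meets_open_interval [OF dense \<open>b > 0\<close>] by blast
  then obtain k where k: "0 < of_int k * c" "of_int k * c < b"
    using gen by blast
  then have "c \<noteq> 0" "k \<noteq> 0" by auto
  then have "1 * \<bar>c\<bar> \<le> \<bar>of_int k\<bar> * \<bar>c\<bar>"
    by (intro mult_right_mono) auto
  then show False
    using k \<open>c \<noteq> 0\<close> by (simp add: b_def flip: abs_mult)
qed

lemma infinitesimal_rank_HG: "infinitesimal_rank HG HT = 2"
proof -
  have "2 \<le> n" if "inf_generated HG HT n" for n
  proof (rule ccontr)
    assume "\<not> 2 \<le> n"
    then have "{i. enat i < n} \<subseteq> {0}"
      by (cases n) (auto simp: numeral_eq_enat)
    moreover from that [unfolded inf_generated_def, rule_format, OF is_nbhd_H]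
    obtain g where g: "g ` {i. enat i < n} \<subseteq> H"
      "HT closure_of (generate HG (g ` {i. enat i < n})) = topspace HT"
      by blast
    ultimately have "\<exists>c\<in>H. g ` {i. enat i < n} \<subseteq> {c}"
      using H_0 by (cases "{i. enat i < n} = {}") auto
    then show False
      using not_dense_one_generator g by blast
  qed
  then show ?thesis
    unfolding infinitesimal_rank_def using inf_generated_2
    by (intro antisym Inf_lower Inf_greatest) auto
qed

text \<open>
  Two elements of an arbitrarily small neighborhood generate a dense subgroup, which therefore
  approaches \<open>2 \<in> H\<close> and leaves the neighborhood \<open>H \<inter> {-1<..<1}\<close>.
\<close>

lemma HG_not_quasi_non_archimedean: "\<not> quasi_non_archimedean HG HT"
proof
  assume qna: "quasi_non_archimedean HG HT"
  define V where "V = H \<inter> {-1<..<1::real}"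
  have "openin HT V"
    unfolding V_def by (intro openin_HT_real) simp
  moreover have "\<one>\<^bsub>HG\<^esub> \<in> V"
    using H_0 by (simp add: V_def)
  ultimately have nbhd: "is_nbhd HT \<one>\<^bsub>HG\<^esub> V"
    unfolding is_nbhd_def by (metis interior_of_openin openin_subset)
  from qna [unfolded quasi_non_archimedean_def, rule_format, OF nbhd, of 2]
  obtain U where U: "is_nbhd HT \<one>\<^bsub>HG\<^esub> U"
    and gen: "\<forall>g :: nat \<Rightarrow> real. g ` {..<2} \<subseteq> U \<longrightarrow> generate HG (g ` {..<2}) \<subseteq> V"
    by (elim exE conjE) (rule that)
  have two: "{i. enat i < 2} = {..<2 :: nat}"
    by (auto simp: numeral_eq_enat)
  from inf_generated_2 [unfolded inf_generated_def two, rule_format, OF U]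
  obtain g :: "nat \<Rightarrow> real" where g: "g ` {..<2} \<subseteq> U"
    and dense: "HT closure_of (generate HG (g ` {..<2})) = topspace HT"
    by (elim exE conjE) (rule that)
  have "2 \<in> H"
    using int_in_dyadics [of 2] dyadics_subset_H by auto
  then have "\<exists>y \<in> generate HG (g ` {..<2}). 1 < y \<and> y < 3"
    by (intro dense_meets_open_interval [OF dense, of 1 3 2]) simp_all
  then obtain y where y: "y \<in> generate HG (g ` {..<2})" "1 < y"
    by (elim bexE conjE) (rule that)
  have "y \<in> V"
    using gen [rule_format, OF g] y(1) by (rule subsetD)
  with y(2) show False
    by (simp add: V_def)
qed

theorem corollary5p14:
  shows "(\<exists>(G :: continuum monoid) T.
            polish_group G T \<and> totally_disconnected_space T \<and> infinitesimal_rank G T = 2)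
       \<and> (\<exists>(G :: continuum monoid) T.
            polish_group G T \<and> totally_disconnected_space T \<and> \<not> quasi_non_archimedean G T)"
  using HG_polish HT_totally_disconnected infinitesimal_rank_HG HG_not_quasi_non_archimedean
  by blast

end
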